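(* Let $X$ be a compact metrizable space equipped with a free continuous action of a compact group $G$. Then $$\dim\big((X*G)/G\big)\le\max\big(\dim(X/G),\ \dim(X)+1\big),$$ where $X*G$ carries the diagonal $G$-action.
   Context: Topological groups are Hausdorff. $\dim$ denotes covering dimension (equal to the inductive dimensions for separable metrizable spaces), which may take the value $\infty$. For compact spaces $X,Y$, the topological join $X*Y$ is the quotient of $X\times Y\times[0,1]$ by the relation which, for each fixed $y_0\in Y$, identifies all points $(x,y_0,0)$ ($x\in X$), and, for each fixed $x_0\in X$, identifies all points $(x_0,y,1)$ ($y\in Y$). The diagonal action on $X*G$ is $[(x,h,t)]\cdot g=[(xg,hg,t)]$. *)

theory Defs
  imports "HOL-Analysis.Analysis" "HOL-Algebra.Group_Action"
begin

section \<open>Covering dimension\<close>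

definition finite_open_cover :: "'a topology \<Rightarrow> 'a set set \<Rightarrow> bool" where
  "finite_open_cover X \<U> \<longleftrightarrow>
     finite \<U> \<and> (\<forall>U\<in>\<U>. openin X U) \<and> \<Union>\<U> = topspace X"

text \<open>
  Lebesgue covering dimension in the form using finite open covers. On compact spaces, the only
  ones considered here, arbitrary open covers give the same notion. The refinement \<open>\<V>\<close> is finite,
  so \<open>card\<close> is the true number of members containing a point.
\<close>

definition covering_dim_le :: "'a topology \<Rightarrow> int \<Rightarrow> bool" where
  "covering_dim_le X n \<longleftrightarrow>
     (\<forall>\<U>. finite_open_cover X \<U> \<longrightarrow>
        (\<exists>\<V>. finite_open_cover X \<V> \<and> (\<forall>V\<in>\<V>. \<exists>U\<in>\<U>. V \<subseteq> U) \<and>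
             (\<forall>x\<in>topspace X. int (card {V \<in> \<V>. x \<in> V}) \<le> n + 1)))"

text \<open>The infimum is \<open>\<infinity>\<close> if there is no finite bound, and \<open>-1\<close> exactly for the empty space.\<close>

definition covering_dim :: "'a topology \<Rightarrow> ereal" where
  "covering_dim X = Inf {ereal (real_of_int n) |n. -1 \<le> n \<and> covering_dim_le X n}"

lemma covering_dim_le_mono:
  "covering_dim_le X m \<Longrightarrow> m \<le> n \<Longrightarrow> covering_dim_le X n"
  unfolding covering_dim_le_def by (meson add_right_mono order.trans)

lemma covering_dim_le_iff:
  assumes "-1 \<le> n"
  shows "covering_dim X \<le> ereal (real_of_int n) \<longleftrightarrow> covering_dim_le X n"
proof
  assume "covering_dim X \<le> ereal (real_of_int n)"
  then have "covering_dim X < ereal (real_of_int (n + 1))"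
    by (rule le_less_trans) simp
  then obtain m where "covering_dim_le X m" "m < n + 1"
    unfolding covering_dim_def Inf_less_iff less_ereal.simps of_int_less_iff by auto
  then show "covering_dim_le X n"
    by (intro covering_dim_le_mono[of X m n]) simp_all
next
  assume "covering_dim_le X n"
  with assms show "covering_dim X \<le> ereal (real_of_int n)"
    unfolding covering_dim_def by (intro Inf_lower) auto
qed

lemma covering_dim_le_minus_one_iff: "covering_dim_le X (-1) \<longleftrightarrow> topspace X = {}"
proof
  assume dim: "covering_dim_le X (-1)"
  have "finite_open_cover X {topspace X}"
    by (simp add: finite_open_cover_def)
  then obtain \<V> where \<V>: "finite_open_cover X \<V>"
    and card: "\<And>x. x \<in> topspace X \<Longrightarrow> int (card {V \<in> \<V>. x \<in> V}) \<le> -1 + 1"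
    using dim unfolding covering_dim_le_def by meson
  show "topspace X = {}"
  proof (rule equals0I)
    fix x assume x: "x \<in> topspace X"
    have "finite {V \<in> \<V>. x \<in> V}"
      using \<V> by (simp add: finite_open_cover_def)
    then have "{V \<in> \<V>. x \<in> V} = {}"
      using card[OF x] by simp
    moreover have "x \<in> \<Union>\<V>"
      using \<V> x by (simp add: finite_open_cover_def)
    ultimately show False by blast
  qed
next
  assume "topspace X = {}"
  then show "covering_dim_le X (-1)"
    unfolding covering_dim_le_def finite_open_cover_def
    by (intro allI impI exI[of _ "{}"]) auto
qed


section \<open>Quotient topologies\<close>

definition quotient_topology :: "'a topology \<Rightarrow> ('a \<Rightarrow> 'b) \<Rightarrow> 'b topology" where
  "quotient_topology X q =
     topology (\<lambda>U. U \<subseteq> q ` topspace X \<and> openin X {x \<in> topspace X. q x \<in> U})"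

lemma openin_quotient_topology:
  "openin (quotient_topology X q) U \<longleftrightarrow>
     U \<subseteq> q ` topspace X \<and> openin X {x \<in> topspace X. q x \<in> U}"
proof -
  have "istopology (\<lambda>U. U \<subseteq> q ` topspace X \<and> openin X {x \<in> topspace X. q x \<in> U})"
    unfolding istopology_def
  proof (intro conjI allI impI)
    fix S T
    assume S: "S \<subseteq> q ` topspace X \<and> openin X {x \<in> topspace X. q x \<in> S}"
      and T: "T \<subseteq> q ` topspace X \<and> openin X {x \<in> topspace X. q x \<in> T}"
    have "{x \<in> topspace X. q x \<in> S \<inter> T} =
        {x \<in> topspace X. q x \<in> S} \<inter> {x \<in> topspace X. q x \<in> T}" by auto
    with S T show "openin X {x \<in> topspace X. q x \<in> S \<inter> T}" by auto
    from S show "S \<inter> T \<subseteq> q ` topspace X" by auto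
  next
    fix \<K>
    assume K: "\<forall>K\<in>\<K>. K \<subseteq> q ` topspace X \<and> openin X {x \<in> topspace X. q x \<in> K}"
    have "{x \<in> topspace X. q x \<in> \<Union>\<K>} = (\<Union>K\<in>\<K>. {x \<in> topspace X. q x \<in> K})" by auto
    with K show "openin X {x \<in> topspace X. q x \<in> \<Union>\<K>}" by auto
    from K show "\<Union>\<K> \<subseteq> q ` topspace X" by auto
  qed
  then show ?thesis
    unfolding quotient_topology_def by (simp add: topology_inverse')
qed

lemma topspace_quotient_topology [simp]:
  "topspace (quotient_topology X q) = q ` topspace X"
proof
  show "topspace (quotient_topology X q) \<subseteq> q ` topspace X"
    unfolding topspace_def[of "quotient_topology X q"] by (auto simp: openin_quotient_topology)
  have "{x \<in> topspace X. q x \<in> q ` topspace X} = topspace X" by auto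
  then have "openin (quotient_topology X q) (q ` topspace X)"
    by (simp add: openin_quotient_topology)
  then show "q ` topspace X \<subseteq> topspace (quotient_topology X q)"
    by (rule openin_subset)
qed

lemma quotient_map_quotient_topology: "quotient_map X (quotient_topology X q) q"
  unfolding quotient_map_def by (simp add: openin_quotient_topology)


section \<open>Topological groups and their actions\<close>

locale topological_group = group G for G (structure) +
  fixes T :: "'g topology"
  assumes topspace_eq: "topspace T = carrier G"
    and Hausdorff: "Hausdorff_space T"
    and continuous_mult: "continuous_map (prod_topology T T) T (\<lambda>(g, h). g \<otimes> h)"
    and continuous_inv: "continuous_map T T (\<lambda>g. inv g)"

locale continuous_right_action = topological_group G T for G (structure) and T :: "'g topology" +
  fixes X :: "'a topology" and act :: "'a \<Rightarrow> 'g \<Rightarrow> 'a"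
  assumes act_one: "x \<in> topspace X \<Longrightarrow> act x \<one> = x"
    and act_mult: "\<lbrakk>x \<in> topspace X; g \<in> carrier G; h \<in> carrier G\<rbrakk>
        \<Longrightarrow> act x (g \<otimes> h) = act (act x g) h"
    and continuous_act: "continuous_map (prod_topology X T) X (\<lambda>(x, g). act x g)"

locale free_continuous_right_action = continuous_right_action +
  assumes free: "\<lbrakk>x \<in> topspace X; g \<in> carrier G; act x g = x\<rbrakk> \<Longrightarrow> g = \<one>"

text \<open>\<open>orbit\<close> takes the acting element first, hence the swap of arguments.\<close>

definition orbit_space ::
    "('g, 'm) monoid_scheme \<Rightarrow> 'a topology \<Rightarrow> ('a \<Rightarrow> 'g \<Rightarrow> 'a) \<Rightarrow> 'a set topology" where
  "orbit_space G X act = quotient_topology X (orbit G (\<lambda>g x. act x g))"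


section \<open>The topological join\<close>

definition join_base :: "'a topology \<Rightarrow> 'b topology \<Rightarrow> ('a \<times> 'b \<times> real) topology" where
  "join_base X Y = prod_topology X (prod_topology Y (top_of_set {0..1}))"

definition join_rel :: "'a topology \<Rightarrow> 'b topology \<Rightarrow> ('a \<times> 'b \<times> real) rel" where
  "join_rel X Y =
     {((x, y, s), (x', y', t)).
        (x, y, s) \<in> topspace (join_base X Y) \<and> (x', y', t) \<in> topspace (join_base X Y) \<and> s = t \<and>
        (x = x' \<and> y = y' \<or> s = 0 \<and> y = y' \<or> s = 1 \<and> x = x')}"

lemma equiv_join_rel: "equiv (topspace (join_base X Y)) (join_rel X Y)"
proof (rule equivI)
  show "join_rel X Y \<subseteq> topspace (join_base X Y) \<times> topspace (join_base X Y)"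
    unfolding join_rel_def by blast
  show "refl_on (topspace (join_base X Y)) (join_rel X Y)"
    by (rule refl_onI) (clarsimp simp: join_rel_def)
  show "sym (join_rel X Y)"
    unfolding join_rel_def sym_def by blast
  show "trans (join_rel X Y)"
  proof (rule transI)
    fix p q r assume "(p, q) \<in> join_rel X Y" "(q, r) \<in> join_rel X Y"
    then show "(p, r) \<in> join_rel X Y"
      unfolding join_rel_def by (cases p; cases q; cases r) (clarsimp, elim disjE; simp)
  qed
qed

definition join_class ::
    "'a topology \<Rightarrow> 'b topology \<Rightarrow> 'a \<times> 'b \<times> real \<Rightarrow> ('a \<times> 'b \<times> real) set" where
  "join_class X Y p = join_rel X Y `` {p}"

definition join_space :: "'a topology \<Rightarrow> 'b topology \<Rightarrow> ('a \<times> 'b \<times> real) set topology" where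
  "join_space X Y = quotient_topology (join_base X Y) (join_class X Y)"

text \<open>
  The diagonal action on classes, \<open>[(x, h, t)] \<cdot> g = [(x \<cdot> g, h g, t)]\<close>: the class \<open>C\<close> is sent to
  the union of the classes of its translated representatives. These all coincide, so that the union
  is a single class; see \<open>join_diag_class\<close>.
\<close>

definition join_diag ::
    "('g, 'm) monoid_scheme \<Rightarrow> 'g topology \<Rightarrow> 'a topology \<Rightarrow> ('a \<Rightarrow> 'g \<Rightarrow> 'a)
      \<Rightarrow> ('a \<times> 'g \<times> real) set \<Rightarrow> 'g \<Rightarrow> ('a \<times> 'g \<times> real) set" where
  "join_diag G T X act C g = (\<Union>(x, h, t)\<in>C. join_class X T (act x g, h \<otimes>\<^bsub>G\<^esub> g, t))"

lemma (in continuous_right_action) act_closed: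
  "x \<in> topspace X \<Longrightarrow> g \<in> carrier G \<Longrightarrow> act x g \<in> topspace X"
  using continuous_map_image_subset_topspace[OF continuous_act] by (auto simp: topspace_eq)

lemma (in continuous_right_action) join_diag_class:
  assumes "x \<in> topspace X" "h \<in> carrier G" "t \<in> {0..1}" "g \<in> carrier G"
  shows "join_diag G T X act (join_class X T (x, h, t)) g = join_class X T (act x g, h \<otimes> g, t)"
proof -
  have same: "join_class X T (act x' g, h' \<otimes> g, t') = join_class X T (act x g, h \<otimes> g, t)"
    if "(x', h', t') \<in> join_class X T (x, h, t)" for x' h' t'
    unfolding join_class_def
  proof (rule equiv_class_eq[OF equiv_join_rel])
    show "((act x' g, h' \<otimes> g, t'), (act x g, h \<otimes> g, t)) \<in> join_rel X T"
      using that assms act_closed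
      by (auto simp: join_class_def join_rel_def join_base_def topspace_eq)
  qed
  have ne: "join_class X T (x, h, t) \<noteq> {}"
    using assms by (auto simp: join_class_def join_rel_def join_base_def topspace_eq)
  have "join_diag G T X act (join_class X T (x, h, t)) g =
      (\<Union>p\<in>join_class X T (x, h, t). join_class X T (act x g, h \<otimes> g, t))"
    unfolding join_diag_def
  proof (rule SUP_cong[OF refl])
    fix p assume p: "p \<in> join_class X T (x, h, t)"
    obtain x' h' t' where "p = (x', h', t')" by (cases p)
    with p same show "(case p of (x, h, t) \<Rightarrow> join_class X T (act x g, h \<otimes> g, t)) =
        join_class X T (act x g, h \<otimes> g, t)" by simp
  qed
  with ne show ?thesis by simp
qed

end

theory Submission
  imports Defs
begin

text \<open>
  Every \<open>G\<close>-orbit in \<open>X \<times> G\<close> has exactly one representative \<open>(x, \<one>)\<close>, so \<open>(X * G)/G\<close> is the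
  mapping cone of the orbit map \<open>q : X \<rightarrow> X/G\<close>: the quotient of \<open>X \<times> [0,1]\<close> that collapses
  \<open>X \<times> {0}\<close> to a point and \<open>X \<times> {1}\<close> to \<open>X/G\<close>.

  Let \<open>dim X \<le> n - 1\<close> and \<open>dim (X/G) \<le> n\<close>. Given an open cover of the cone, choose a cover \<open>\<P>\<close> of
  \<open>X/G\<close> of order \<open>n + 1\<close> that refines it near \<open>X/G\<close>, and a cover \<open>V\<^sub>0, \<dots>, V\<^sub>m\<^sub>-\<^sub>1\<close> of \<open>X\<close> of order
  \<open>n\<close> that refines both \<open>q\<^sup>-\<^sup>1(\<P>)\<close> and the given cover on short cylinders. The partial sums
  \<open>0 = s\<^sub>0 \<le> \<dots> \<le> s\<^sub>m = 1\<close> of a partition of unity subordinate to the \<open>V\<^sub>i\<close> cut \<open>[t, t + 1]\<close> into the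
  intervals \<open>[s\<^sub>i + t, s\<^sub>i\<^sub>+\<^sub>1 + t]\<close>, of which at most \<open>n\<close> are nondegenerate, and one integer cuts at most
  one of them again. Hence the sets of all \<open>(x, t)\<close> for which the \<open>i\<close>-th interval meets \<open>(j, j + 1)\<close>
  form an open cover of the cylinder of order \<open>n + 1\<close>; it is the pullback of the star cover of a
  triangulated prism. Merging the sets with \<open>j = 0\<close>, and those with large \<open>j\<close> according to the
  member of \<open>\<P>\<close> containing \<open>q(V\<^sub>i)\<close>, does not increase the order and makes the cover descend to the
  cone.
\<close>

lemma compact_space_indexed_subcover:
  assumes "compact_space X" and A: "\<And>x. x \<in> topspace X \<Longrightarrow> openin X (A x) \<and> x \<in> A x"
  obtains K where "K \<subseteq> topspace X" "finite K" "\<Union>(A ` K) = topspace X"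
proof -
  have "\<exists>\<F>. finite \<F> \<and> \<F> \<subseteq> A ` topspace X \<and> topspace X \<subseteq> \<Union>\<F>"
    using assms by (intro compactinD[of X]) (auto simp: compact_space_def)
  then obtain K where K: "K \<subseteq> topspace X" "finite K" "topspace X \<subseteq> \<Union>(A ` K)"
    by (metis finite_subset_image)
  moreover have "A x \<subseteq> topspace X" if "x \<in> K" for x
    using A K(1) that openin_subset[of X "A x"] by blast
  ultimately show thesis by (intro that[of K]) blast+
qed

lemma finite_cover_uniform_slices:
  assumes X: "compact_space X"
    and \<U>: "\<And>x t. x \<in> topspace X \<Longrightarrow> t \<in> {0..1} \<Longrightarrow>
          \<exists>U\<in>\<U>. openin (prod_topology X (top_of_set {0..1::real})) U \<and> (x, t) \<in> U"
  obtains \<A> r where "finite_open_cover X \<A>" "0 < r"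
    "\<And>A c. A \<in> \<A> \<Longrightarrow> c \<in> {0..1} \<Longrightarrow> \<exists>U\<in>\<U>. A \<times> (ball c r \<inter> {0..1}) \<subseteq> U"
proof -
  have loc: "\<exists>A r. openin X A \<and> x \<in> A \<and> 0 < r \<and> (\<exists>U\<in>\<U>. A \<times> (ball t (2 * r) \<inter> {0..1}) \<subseteq> U)"
    if x: "x \<in> topspace X" and t: "t \<in> {0..1}" for x t
  proof -
    obtain U where U: "U \<in> \<U>" "openin (prod_topology X (top_of_set {0..1})) U" "(x, t) \<in> U"
      using \<U>[OF x t] by blast
    then obtain A B where A: "openin X A" "openin (top_of_set {0..1}) B" "x \<in> A" "t \<in> B" "A \<times> B \<subseteq> U"
      by (metis openin_prod_topology_alt)
    then obtain r where r: "r > 0" "ball t r \<inter> {0..1} \<subseteq> B"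
      using openin_contains_ball by metis
    have "A \<times> (ball t (2 * (r / 2)) \<inter> {0..1}) \<subseteq> U"
      using A(5) r(2) by auto
    then show ?thesis
      using U(1) A r(1) by (intro exI[of _ A] exI[of _ "r/2"]) auto
  qed
  have slice: "\<exists>A r. openin X A \<and> x \<in> A \<and> 0 < r \<and>
      (\<forall>c\<in>{0..1}. \<exists>U\<in>\<U>. A \<times> (ball c r \<inter> {0..1}) \<subseteq> U)" if x: "x \<in> topspace X" for x
  proof -
    obtain A r where Ar: "\<And>t. t \<in> {0..1} \<Longrightarrow> openin X (A t) \<and> x \<in> A t \<and> 0 < (r t :: real) \<and>
        (\<exists>U\<in>\<U>. A t \<times> (ball t (2 * r t) \<inter> {0..1}) \<subseteq> U)"
      using loc[OF x] by metis
    have "compact {0..1::real}" "\<And>t. t \<in> {0..1} \<Longrightarrow> open (ball t (r t))"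
      "{0..1} \<subseteq> (\<Union>t\<in>{0..1}. ball t (r t))"
      using Ar by auto
    then obtain K where K: "K \<subseteq> {0..1}" "finite K" "{0..1} \<subseteq> (\<Union>t\<in>K. ball t (r t))"
      by (rule compactE_image)
    have "(0::real) \<in> {0..1}" by simp
    then have Kne: "K \<noteq> {}" using K(3) by blast
    define \<rho> where "\<rho> = Min (r ` K)"
    have \<rho>: "\<rho> > 0" "\<And>t. t \<in> K \<Longrightarrow> \<rho> \<le> r t"
      unfolding \<rho>_def using K Kne Ar by auto
    have "\<exists>U\<in>\<U>. \<Inter>(A ` K) \<times> (ball c \<rho> \<inter> {0..1}) \<subseteq> U" if c: "c \<in> {0..1}" for c
    proof -
      obtain t where t: "t \<in> K" "c \<in> ball t (r t)" using K(3) c by blast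
      obtain U where U: "U \<in> \<U>" "A t \<times> (ball t (2 * r t) \<inter> {0..1}) \<subseteq> U"
        using Ar[of t] t(1) K(1) by blast
      have "ball c \<rho> \<subseteq> ball t (2 * r t)"
        using t(2) \<rho>(2)[OF t(1)] by (auto simp: dist_real_def)
      then show ?thesis using U t(1) by (intro bexI[of _ U] order_trans[OF _ U(2)] Sigma_mono) auto
    qed
    moreover have "openin X (\<Inter>(A ` K))" using K Kne Ar by (intro openin_Inter) auto
    moreover have "x \<in> \<Inter>(A ` K)" using K Ar by blast
    ultimately show ?thesis using \<rho>(1) by blast
  qed
  then obtain A r where Ar: "\<And>x. x \<in> topspace X \<Longrightarrow> openin X (A x) \<and> x \<in> A x \<and> 0 < (r x :: real) \<and>
      (\<forall>c\<in>{0..1}. \<exists>U\<in>\<U>. A x \<times> (ball c (r x) \<inter> {0..1}) \<subseteq> U)"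
    by metis
  obtain K where K: "K \<subseteq> topspace X" "finite K" "\<Union>(A ` K) = topspace X"
    using compact_space_indexed_subcover[of X A] X Ar by blast
  define \<rho> where "\<rho> = Min (insert 1 (r ` K))"
  have \<rho>: "\<rho> > 0" "\<And>t. t \<in> K \<Longrightarrow> \<rho> \<le> r t"
    unfolding \<rho>_def using K Ar by auto
  show thesis
  proof
    show "finite_open_cover X (A ` K)"
      unfolding finite_open_cover_def using K Ar by blast
    show "\<rho> > 0" by fact
    fix A' and c :: real assume "A' \<in> A ` K" and c: "c \<in> {0..1}"
    then obtain x where x: "x \<in> K" "A' = A x" by blast
    then obtain U where "U \<in> \<U>" "A x \<times> (ball c (r x) \<inter> {0..1}) \<subseteq> U"
      using Ar[of x] K(1) c by blast
    moreover have "ball c \<rho> \<subseteq> ball c (r x)" using \<rho>(2)[OF x(1)] by auto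
    ultimately show "\<exists>U\<in>\<U>. A' \<times> (ball c \<rho> \<inter> {0..1}) \<subseteq> U"
      using x(2) by (intro bexI[of _ U]) auto
  qed
qed

lemma partition_of_unity_finite_open_cover:
  assumes X: "compact_space X" "completely_regular_space X" and \<V>: "finite_open_cover X \<V>"
  obtains \<phi> :: "'a set \<Rightarrow> 'a \<Rightarrow> real" where
    "\<And>V. V \<in> \<V> \<Longrightarrow> continuous_map X euclideanreal (\<phi> V)"
    "\<And>V x. V \<in> \<V> \<Longrightarrow> x \<in> topspace X \<Longrightarrow> 0 \<le> \<phi> V x"
    "\<And>V x. V \<in> \<V> \<Longrightarrow> x \<in> topspace X \<Longrightarrow> x \<notin> V \<Longrightarrow> \<phi> V x = 0"
    "\<And>x. x \<in> topspace X \<Longrightarrow> (\<Sum>V\<in>\<V>. \<phi> V x) = 1"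
proof -
  have "\<exists>V f. V \<in> \<V> \<and> continuous_map X euclideanreal f \<and> f x = 0 \<and> f ` (topspace X - V) \<subseteq> {1::real}"
    if x: "x \<in> topspace X" for x
  proof -
    obtain V where "V \<in> \<V>" "x \<in> V" "openin X V"
      using x \<V> unfolding finite_open_cover_def by blast
    then show ?thesis
      using X(2) unfolding completely_regular_space_alt' by meson
  qed
  then obtain v f where vf: "\<And>x. x \<in> topspace X \<Longrightarrow> v x \<in> \<V> \<and> continuous_map X euclideanreal (f x) \<and>
      f x x = 0 \<and> f x ` (topspace X - v x) \<subseteq> {1::real}"
    by metis
  define A where "A x = {y \<in> topspace X. f x y < 1}" for x
  have A: "openin X (A x)" "x \<in> A x" if "x \<in> topspace X" for x
    using vf[OF that] that unfolding A_def continuous_map_upper_lower_semicontinuous_lt by auto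
  obtain K where K: "K \<subseteq> topspace X" "finite K" "\<Union>(A ` K) = topspace X"
    using compact_space_indexed_subcover[of X A] X A by blast
  define g where "g x y = max 0 (1 - f x y)" for x y
  define \<psi> where "\<psi> V y = (\<Sum>x\<in>{x\<in>K. v x = V}. g x y)" for V y
  have cont_g: "continuous_map X euclideanreal (g x)" if "x \<in> K" for x
    unfolding g_def using vf K(1) that by (intro continuous_intros) auto
  then have cont_\<psi>: "continuous_map X euclideanreal (\<psi> V)" for V
    unfolding \<psi>_def using K(2) by (intro continuous_intros) auto
  have pos_\<psi>: "0 \<le> \<psi> V y" for V y
    unfolding \<psi>_def g_def by (intro sum_nonneg) auto
  have supp_\<psi>: "\<psi> V y = 0" if "y \<in> topspace X" "y \<notin> V" for V y
    unfolding \<psi>_def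
  proof (intro sum.neutral ballI)
    fix x assume "x \<in> {x \<in> K. v x = V}"
    then have "f x y = 1" using vf[of x] K(1) that by auto
    then show "g x y = 0" by (simp add: g_def)
  qed
  have fin: "finite \<V>" using \<V> by (simp add: finite_open_cover_def)
  have vK: "v ` K \<subseteq> \<V>" using vf K(1) by blast
  have sum_\<psi>: "(\<Sum>V\<in>\<V>. \<psi> V y) = (\<Sum>x\<in>K. g x y)" for y
    unfolding \<psi>_def by (rule sum.group[OF K(2) fin vK])
  have pos: "(\<Sum>V\<in>\<V>. \<psi> V y) > 0" if y: "y \<in> topspace X" for y
  proof -
    obtain x where x: "x \<in> K" "y \<in> A x" using y unfolding K(3)[symmetric] by blast
    have "0 < g x y" using x by (simp add: g_def A_def)
    also have "g x y \<le> (\<Sum>x\<in>K. g x y)"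
      using x K(2) by (intro member_le_sum) (auto simp: g_def)
    finally show ?thesis by (simp add: sum_\<psi>)
  qed
  show thesis
  proof
    show "continuous_map X euclideanreal (\<lambda>y. \<psi> V y / (\<Sum>V\<in>\<V>. \<psi> V y))" for V
      using pos[THEN less_imp_neq] by (intro continuous_intros cont_\<psi> fin) auto
    show "0 \<le> \<psi> V y / (\<Sum>V\<in>\<V>. \<psi> V y)" for V y
      by (intro divide_nonneg_nonneg sum_nonneg pos_\<psi>)
    show "\<psi> V y / (\<Sum>V\<in>\<V>. \<psi> V y) = 0" if "y \<in> topspace X" "y \<notin> V" for V y
      using supp_\<psi> that by simp
    show "(\<Sum>V\<in>\<V>. \<psi> V y / (\<Sum>V\<in>\<V>. \<psi> V y)) = 1" if "y \<in> topspace X" for y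
      using pos[OF that] by (simp flip: sum_divide_distrib)
  qed
qed

definition staircase_cells :: "nat \<Rightarrow> (nat \<Rightarrow> real) \<Rightarrow> real \<Rightarrow> (nat \<times> nat) set" where
  "staircase_cells m s t =
     {(i, j). i < m \<and> max (s i + t) (real j) < min (s (Suc i) + t) (real j + 1)}"

lemma finite_staircase_cells_card:
  fixes s :: "nat \<Rightarrow> real"
  assumes s: "\<And>i. i < m \<Longrightarrow> s i \<le> s (Suc i)" "s 0 = 0" "s m = 1" and t: "0 \<le> t"
  shows "finite (staircase_cells m s t)"
    and "card (staircase_cells m s t) \<le> card {i. i < m \<and> s i < s (Suc i)} + 1"
proof -
  define k where "k = nat \<lfloor>t\<rfloor>"
  have k: "real k \<le> t" "t < real k + 1"
    using t unfolding k_def by linarith+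
  have mono: "s i \<le> s j" if "i \<le> j" "j \<le> m" for i j
    using that
  proof (induction rule: dec_induct)
    case (step n)
    then show ?case using s(1)[of n] by linarith
  qed simp
  have range: "0 \<le> s i" "s i \<le> 1" if "i \<le> m" for i
    using mono[of 0 i] mono[of i m] s that by auto
  define P where "P = {i. i < m \<and> s i < s (Suc i)}"
  define A where "A = {i \<in> P. s i + t < real k + 1}"
  define B where "B = {i \<in> P. real k + 1 < s (Suc i) + t}"
  have fin: "finite P" unfolding P_def by simp
  have sub: "staircase_cells m s t \<subseteq> (A \<times> {k}) \<union> (B \<times> {Suc k})"
  proof
    fix p assume "p \<in> staircase_cells m s t"
    then obtain i j where p: "p = (i, j)" "i < m" and
      lt: "max (s i + t) (real j) < min (s (Suc i) + t) (real j + 1)"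
      by (auto simp: staircase_cells_def)
    have "real j < real k + 2" "real k < real j + 1"
      using lt range[of i] range[of "Suc i"] k p(2) by linarith+
    then have "j = k \<or> j = Suc k" by linarith
    then show "p \<in> (A \<times> {k}) \<union> (B \<times> {Suc k})"
      using p lt by (auto simp: A_def B_def P_def)
  qed
  have finAB: "finite A" "finite B" using fin by (auto simp: A_def B_def)
  then have finU: "finite ((A \<times> {k}) \<union> (B \<times> {Suc k}))" by simp
  then show "finite (staircase_cells m s t)" using sub by (rule rev_finite_subset)
  have "card (staircase_cells m s t) \<le> card ((A \<times> {k}) \<union> (B \<times> {Suc k}))"
    by (rule card_mono[OF finU sub])
  also have "\<dots> \<le> card A + card B"
    using card_Un_le[of "A \<times> {k}" "B \<times> {Suc k}"] by (simp add: card_cartesian_product)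
  also have "\<dots> = card (A \<union> B) + card (A \<inter> B)"
    by (rule card_Un_Int[OF finAB])
  also have "card (A \<union> B) \<le> card P"
    using fin by (intro card_mono) (auto simp: A_def B_def)
  also have "card (A \<inter> B) \<le> 1"
  proof -
    have "i = i'" if "i \<in> A \<inter> B" "i' \<in> A \<inter> B" for i i'
    proof (rule ccontr)
      assume "i \<noteq> i'"
      then consider "Suc i \<le> i'" | "Suc i' \<le> i" by linarith
      then show False
        using that mono[of "Suc i" i'] mono[of "Suc i'" i] by cases (auto simp: A_def B_def P_def)
    qed
    then show ?thesis by (metis One_nat_def card_le_Suc0_iff_eq finAB(1) finite_Int)
  qed
  finally show "card (staircase_cells m s t) \<le> card {i. i < m \<and> s i < s (Suc i)} + 1"
    by (simp add: P_def)
qed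

lemma staircase_cells_first:
  fixes s :: "nat \<Rightarrow> real"
  assumes s: "s 0 = 0" "s m = 1" and t: "0 \<le> t"
  obtains i where "(i, nat \<lfloor>t\<rfloor>) \<in> staircase_cells m s t"
proof -
  define j where "j = (LEAST j. s j > 0)"
  have j: "s j > 0" unfolding j_def by (rule LeastI[of _ m]) (use s in simp)
  have "j \<le> m" unfolding j_def by (rule Least_le) (use s in simp)
  obtain i where i: "j = Suc i" using j s(1) by (cases j) auto
  have "\<not> s i > 0" using not_less_Least[of i "\<lambda>j. s j > 0"] i j_def by simp
  moreover have "real (nat \<lfloor>t\<rfloor>) \<le> t" "t < real (nat \<lfloor>t\<rfloor>) + 1"
    using t by linarith+
  ultimately have "max (s i + t) (real (nat \<lfloor>t\<rfloor>)) < min (s (Suc i) + t) (real (nat \<lfloor>t\<rfloor>) + 1)"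
    using i j by (simp only: max_less_iff_conj min_less_iff_conj) linarith
  then have "(i, nat \<lfloor>t\<rfloor>) \<in> staircase_cells m s t"
    using i \<open>j \<le> m\<close> unfolding staircase_cells_def by auto
  then show thesis ..
qed

lemma covering_dim_leE:
  assumes "covering_dim_le X n" "finite_open_cover X \<U>"
  obtains \<V> where "finite_open_cover X \<V>" "\<And>V. V \<in> \<V> \<Longrightarrow> \<exists>U\<in>\<U>. V \<subseteq> U"
    "\<And>x. x \<in> topspace X \<Longrightarrow> int (card {V \<in> \<V>. x \<in> V}) \<le> n + 1"
  using assms unfolding covering_dim_le_def by metis

lemma covering_dim_le_mapping_cone:
  fixes X :: "'a topology" and Y :: "'b topology" and Z :: "'c topology"
  assumes X: "compact_space X" "completely_regular_space X" "topspace X \<noteq> {}"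
    and q: "continuous_map X Y q" "proper_map X Y q" "q ` topspace X = topspace Y"
    and F: "quotient_map (prod_topology X (top_of_set {0..1::real})) Z F"
    and ker: "\<And>x x' t t'. x \<in> topspace X \<Longrightarrow> x' \<in> topspace X \<Longrightarrow> t \<in> {0..1} \<Longrightarrow> t' \<in> {0..1} \<Longrightarrow>
       F (x, t) = F (x', t') \<longleftrightarrow> t = t' \<and> (x = x' \<or> t = 0 \<or> t = 1 \<and> q x = q x')"
    and dimX: "covering_dim_le X (n - 1)" and dimY: "covering_dim_le Y n"
  shows "covering_dim_le Z n"
  unfolding covering_dim_le_def
proof (intro allI impI)
  fix \<U> assume \<U>: "finite_open_cover Z \<U>"
  define C where "C = prod_topology X (top_of_set {0..1::real})"
  have topC: "topspace C = topspace X \<times> {0..1}" by (simp add: C_def)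
  define W where "W U = {p \<in> topspace C. F p \<in> U}" for U
  have F_img: "F ` topspace C = topspace Z"
    and F_open: "\<And>U. U \<subseteq> topspace Z \<Longrightarrow> openin C {p \<in> topspace C. F p \<in> U} = openin Z U"
    using F unfolding quotient_map_def C_def by auto
  have W_open: "openin C (W U)" if "U \<in> \<U>" for U
    using F_open[of U] \<U> that openin_subset[of Z U] unfolding W_def finite_open_cover_def by blast
  have W_cover: "\<exists>U\<in>\<U>. p \<in> W U" if "p \<in> topspace C" for p
  proof -
    have "F p \<in> \<Union>\<U>" using \<U> F_img that by (auto simp: finite_open_cover_def)
    then show ?thesis using that by (auto simp: W_def)
  qed
  have W_end: "(x', 1) \<in> W U"
    if "(x, 1) \<in> W U" "x' \<in> topspace X" "q x = q x'" for x x' U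
  proof -
    have "F (x, 1) = F (x', 1)" using ker[of x x' 1 1] that by (auto simp: W_def topC)
    then show ?thesis using that by (auto simp: W_def topC)
  qed
  have Y: "compact_space Y"
    using image_compactin[OF X(1)[unfolded compact_space_def] q(1)] q(3) by (simp add: compact_space_def)

  obtain x0 where x0: "x0 \<in> topspace X" using X(3) by blast
  obtain U0 where U0: "U0 \<in> \<U>" "(x0, 0) \<in> W U0"
    using W_cover[of "(x0, 0)"] x0 by (auto simp: topC)
  have cone: "(x, 0) \<in> W U0" if "x \<in> topspace X" for x
  proof -
    have "F (x0, 0) = F (x, 0)" using ker[of x0 x 0 0] x0 that by auto
    then show ?thesis using that U0 by (auto simp: W_def topC)
  qed
  obtain r0 where r0: "r0 > 0" "\<And>x t. x \<in> topspace X \<Longrightarrow> t \<in> {0..1} \<Longrightarrow> t < r0 \<Longrightarrow> (x, t) \<in> W U0"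
  proof -
    have "closedin C (topspace C - W U0)" using W_open[OF U0(1)] by blast
    then have "closedin (top_of_set {0..1}) (snd ` (topspace C - W U0))"
      using closed_map_snd[OF X(1)] unfolding closed_map_def C_def by blast
    then have "openin (top_of_set {0..1}) ({0..1} - snd ` (topspace C - W U0))"
      by (simp add: openin_diff)
    moreover have "0 \<in> {0..1} - snd ` (topspace C - W U0)"
      using cone by (auto simp: topC)
    ultimately obtain e where e: "e > 0" "ball 0 e \<inter> {0..1} \<subseteq> {0..1} - snd ` (topspace C - W U0)"
      unfolding openin_contains_ball by meson
    show thesis
    proof (rule that[OF e(1)])
      fix x t assume a: "x \<in> topspace X" "t \<in> {0..1}" "t < e"
      then have "t \<in> ball 0 e \<inter> {0..1}" by (auto simp: dist_real_def)
      then have "t \<notin> snd ` (topspace C - W U0)" using e(2) by blast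
      then show "(x, t) \<in> W U0" using a by (force simp: topC)
    qed
  qed

  have "\<exists>U'\<in>W ` \<U>. openin (prod_topology X (top_of_set {0..1})) U' \<and> (x, t) \<in> U'"
    if x: "x \<in> topspace X" and t: "t \<in> {0..1}" for x t
  proof -
    obtain U where "U \<in> \<U>" "(x, t) \<in> W U" using W_cover[of "(x, t)"] x t by (auto simp: topC)
    then show ?thesis using W_open[of U] by (auto simp: C_def)
  qed
  from finite_cover_uniform_slices[OF X(1) this]
  obtain \<A> r1 where A: "finite_open_cover X \<A>" "r1 > 0"
    "\<And>A c. A \<in> \<A> \<Longrightarrow> c \<in> {0..1} \<Longrightarrow> \<exists>U'\<in>W ` \<U>. A \<times> (ball c r1 \<inter> {0..1}) \<subseteq> U'"
    by metis

  define D where "D U = {(y, t). y \<in> topspace Y \<and> t \<in> {0..1} \<and>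
      (\<forall>x\<in>topspace X. q x = y \<longrightarrow> (x, t) \<in> W U)}" for U
  have D_open: "openin (prod_topology Y (top_of_set {0..1})) (D U)" if U: "U \<in> \<U>" for U
  proof -
    have "proper_map C (prod_topology Y (top_of_set {0..1})) (\<lambda>(x, t). (q x, id t))"
      unfolding C_def proper_map_prod using q(2) proper_map_id by blast
    moreover have "closedin C (topspace C - W U)" using W_open[OF U] by blast
    ultimately have cl: "closedin (prod_topology Y (top_of_set {0..1}))
        ((\<lambda>(x, t). (q x, id t)) ` (topspace C - W U))"
      unfolding proper_map_def closed_map_def by blast
    have "D U = topspace (prod_topology Y (top_of_set {0..1}))
        - (\<lambda>(x, t). (q x, id t)) ` (topspace C - W U)"
      by (auto simp: D_def topC image_iff)
    then show ?thesis using openin_diff[OF openin_topspace cl] by simp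
  qed
  define E0 where "E0 = topspace Y \<times> {0..<1::real}"
  have E0_open: "openin (prod_topology Y (top_of_set {0..1})) E0"
  proof -
    have "{0..<1} = {0..1} \<inter> {..<1::real}" by auto
    then have "openin (top_of_set {0..1}) {0..<1::real}" by (metis open_lessThan openin_open_Int)
    then show ?thesis by (simp add: E0_def openin_prod_Times_iff)
  qed
  have "\<exists>U'\<in>insert E0 (D ` \<U>). openin (prod_topology Y (top_of_set {0..1})) U' \<and> (y, t) \<in> U'"
    if y: "y \<in> topspace Y" and t: "t \<in> {0..1}" for y t
  proof (cases "t = 1")
    case True
    obtain x where x: "x \<in> topspace X" "q x = y" using y unfolding q(3)[symmetric] by blast
    obtain U where U: "U \<in> \<U>" "(x, 1) \<in> W U"
      using W_cover[of "(x, 1)"] x by (auto simp: topC)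
    have "(y, t) \<in> D U" using W_end[OF U(2)] x y True by (auto simp: D_def)
    then show ?thesis using D_open U(1) by blast
  next
    case False
    then have "(y, t) \<in> E0" using y t by (auto simp: E0_def)
    then show ?thesis using E0_open by blast
  qed
  from finite_cover_uniform_slices[OF Y this]
  obtain \<B> r2 where B: "finite_open_cover Y \<B>" "r2 > 0"
    "\<And>B c. B \<in> \<B> \<Longrightarrow> c \<in> {0..1} \<Longrightarrow> \<exists>U'\<in>insert E0 (D ` \<U>). B \<times> (ball c r2 \<inter> {0..1}) \<subseteq> U'"
    by metis
  have ends: "\<exists>U\<in>\<U>. \<forall>x\<in>topspace X. \<forall>t\<in>{0..1}. q x \<in> B \<longrightarrow> 1 - r2 < t \<longrightarrow> (x, t) \<in> W U"
    if B': "B \<in> \<B>" "B \<noteq> {}" for B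
  proof -
    obtain U' where U': "U' \<in> insert E0 (D ` \<U>)" "B \<times> (ball 1 r2 \<inter> {0..1}) \<subseteq> U'"
      using B(3)[OF B'(1), of 1] by auto
    obtain y where "y \<in> B" using B'(2) by blast
    then have "(y, 1::real) \<in> B \<times> (ball 1 r2 \<inter> {0..1})" using B(2) by simp
    moreover have "(y, 1) \<notin> E0" by (simp add: E0_def)
    ultimately have "\<not> B \<times> (ball 1 r2 \<inter> {0..1}) \<subseteq> E0" by blast
    then obtain U where U: "U \<in> \<U>" "B \<times> (ball 1 r2 \<inter> {0..1}) \<subseteq> D U" using U' by blast
    have "(x, t) \<in> W U" if "x \<in> topspace X" "t \<in> {0..1}" "q x \<in> B" "1 - r2 < t" for x t
    proof -
      have "(q x, t) \<in> B \<times> (ball 1 r2 \<inter> {0..1})" using that by (auto simp: dist_real_def)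
      then have "(q x, t) \<in> D U" using U(2) by blast
      then show ?thesis using that(1) by (simp add: D_def)
    qed
    then show ?thesis using U(1) by blast
  qed

  obtain \<P> where P: "finite_open_cover Y \<P>" "\<And>P. P \<in> \<P> \<Longrightarrow> \<exists>B\<in>\<B>. P \<subseteq> B"
    "\<And>y. y \<in> topspace Y \<Longrightarrow> int (card {P \<in> \<P>. y \<in> P}) \<le> n + 1"
    using covering_dim_leE[OF dimY B(1)] by metis
  define pre where "pre P = {x \<in> topspace X. q x \<in> P}" for P
  have pre_open: "openin X (pre P)" if "P \<in> \<P>" for P
    using P(1) that unfolding pre_def finite_open_cover_def
    by (intro openin_continuous_map_preimage[OF q(1)]) blast
  define \<W> where "\<W> = (\<lambda>(A, P). A \<inter> pre P) ` (\<A> \<times> \<P>)"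
  have "finite_open_cover X \<W>"
    unfolding finite_open_cover_def
  proof (intro conjI)
    show "finite \<W>" using A(1) P(1) by (simp add: \<W>_def finite_open_cover_def)
    show op: "\<forall>U\<in>\<W>. openin X U" using A(1) pre_open by (auto simp: \<W>_def finite_open_cover_def)
    show "\<Union>\<W> = topspace X"
    proof
      show "\<Union>\<W> \<subseteq> topspace X" using op openin_subset by blast
      show "topspace X \<subseteq> \<Union>\<W>"
      proof
        fix x assume x: "x \<in> topspace X"
        then have "q x \<in> \<Union>\<P>" using P(1) q(3) by (auto simp: finite_open_cover_def)
        then obtain P where "P \<in> \<P>" "q x \<in> P" by blast
        moreover have "x \<in> \<Union>\<A>" using A(1) x by (simp add: finite_open_cover_def)
        ultimately show "x \<in> \<Union>\<W>" using x by (auto simp: \<W>_def pre_def)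
      qed
    qed
  qed
  from covering_dim_leE[OF dimX this]
  obtain \<V> where V: "finite_open_cover X \<V>" "\<And>V. V \<in> \<V> \<Longrightarrow> \<exists>U\<in>\<W>. V \<subseteq> U"
    "\<And>x. x \<in> topspace X \<Longrightarrow> int (card {V \<in> \<V>. x \<in> V}) \<le> n - 1 + 1"
    by metis
  have "\<exists>A P. A \<in> \<A> \<and> P \<in> \<P> \<and> V \<subseteq> A \<and> V \<subseteq> pre P" if V': "V \<in> \<V>" for V
    using V(2)[OF V'] unfolding \<W>_def by auto
  then obtain a p where ap: "\<And>V. V \<in> \<V> \<Longrightarrow> a V \<in> \<A> \<and> p V \<in> \<P> \<and> V \<subseteq> a V \<and> V \<subseteq> pre (p V)"
    by metis
  obtain \<phi> :: "'a set \<Rightarrow> 'a \<Rightarrow> real" where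
    \<phi>: "\<And>V. V \<in> \<V> \<Longrightarrow> continuous_map X euclideanreal (\<phi> V)"
    "\<And>V x. V \<in> \<V> \<Longrightarrow> x \<in> topspace X \<Longrightarrow> 0 \<le> \<phi> V x"
    "\<And>V x. V \<in> \<V> \<Longrightarrow> x \<in> topspace X \<Longrightarrow> x \<notin> V \<Longrightarrow> \<phi> V x = 0"
    "\<And>x. x \<in> topspace X \<Longrightarrow> (\<Sum>V\<in>\<V>. \<phi> V x) = 1"
    using partition_of_unity_finite_open_cover[OF X(1,2) V(1)] by blast
  obtain h where h: "bij_betw h {0..<card \<V>} \<V>"
    using ex_bij_betw_nat_finite[of \<V>] V(1) by (auto simp: finite_open_cover_def)
  define m where "m = card \<V>"
  have hV: "h i \<in> \<V>" if "i < m" for i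
    using h that by (auto simp: bij_betw_def m_def)
  define s where "s i x = (\<Sum>k<i. \<phi> (h k) x)" for i x
  have s0: "s 0 x = 0" and sSuc: "s (Suc i) x = s i x + \<phi> (h i) x" for i x
    by (simp_all add: s_def)
  have sm: "s m x = 1" if "x \<in> topspace X" for x
  proof -
    have "s m x = (\<Sum>V\<in>\<V>. \<phi> V x)"
      unfolding s_def m_def lessThan_atLeast0 by (rule sum.reindex_bij_betw[OF h])
    then show ?thesis using \<phi>(4)[OF that] by simp
  qed
  have smono: "s i x \<le> s (Suc i) x" if "x \<in> topspace X" "i < m" for i x
    using \<phi>(2)[OF hV that(1)] that(2) by (simp add: sSuc)
  have snn: "0 \<le> s i x" if "x \<in> topspace X" "i \<le> m" for i x
    unfolding s_def using \<phi>(2) hV that by (intro sum_nonneg) auto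
  have sle: "s i x \<le> 1" if "x \<in> topspace X" "i \<le> m" for i x
  proof -
    have "s i x \<le> s m x"
      unfolding s_def using \<phi>(2) hV that by (intro sum_mono2) auto
    then show ?thesis using sm[OF that(1)] by simp
  qed
  have s_cont: "continuous_map X euclideanreal (s i)" if "i \<le> m" for i
    unfolding s_def using \<phi>(1) hV that by (intro continuous_intros) auto
  have s_supp: "x \<in> h i" if "x \<in> topspace X" "i < m" "s i x < s (Suc i) x" for i x
    using \<phi>(3)[OF hV that(1)] that by (force simp: sSuc)

  define r where "r = Min {r0, r1, r2}"
  have r: "r > 0" "r \<le> r0" "r \<le> r1" "r \<le> r2" using r0 A(2) B(2) by (auto simp: r_def)
  obtain N :: nat where N: "2 / r < real N" using reals_Archimedean2 by blast
  have Npos: "0 < N" using N r(1) by (metis divide_pos_pos less_trans of_nat_0_less_iff zero_less_numeral)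
  define M where "M = real N + 1"
    \<comment> \<open>the cylinder coordinate is rescaled to \<open>M * t\<close>, and cells with \<open>N \<le> j\<close> are merged\<close>
  have M: "M > 0" "2 / M < r" using N r(1) by (auto simp: M_def field_simps)
  have M': "\<bar>M * t - c\<bar> < 2 \<Longrightarrow> \<bar>t - c / M\<bar> < r" for t c
  proof -
    assume "\<bar>M * t - c\<bar> < 2"
    moreover have "\<bar>M * t - c\<bar> = M * \<bar>t - c / M\<bar>"
      using M(1) by (simp add: abs_mult[symmetric] field_simps flip: abs_mult_pos')
    ultimately have "M * \<bar>t - c / M\<bar> < 2" by simp
    then have "\<bar>t - c / M\<bar> < 2 / M" using M(1) by (simp add: field_simps)
    then show "\<bar>t - c / M\<bar> < r" using M(2) by simp
  qed

  define cells where "cells x t = staircase_cells m (\<lambda>i. s i x) (M * t)" for x t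
  define Q where "Q i j = {(x, t). x \<in> topspace X \<and> t \<in> {0..1} \<and> (i, j) \<in> cells x t}" for i j
  have Q_D: "i < m" "x \<in> topspace X" "t \<in> {0..1}" "x \<in> h i" "real j - 1 < M * t" "M * t < real j + 1"
    if "(x, t) \<in> Q i j" for i j x t
  proof -
    show im: "i < m" and x: "x \<in> topspace X" and "t \<in> {0..1}"
      using that by (auto simp: Q_def cells_def staircase_cells_def)
    have lt: "s i x + M * t < s (Suc i) x + M * t" "s i x + M * t < real j + 1"
      "real j < s (Suc i) x + M * t"
      using that by (auto simp: Q_def cells_def staircase_cells_def)
    show "x \<in> h i" using lt(1) by (intro s_supp x im) simp
    show "real j - 1 < M * t" using lt(3) sle[OF x, of "Suc i"] im by simp
    show "M * t < real j + 1" using lt(2) snn[OF x, of i] im by simp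
  qed
  have Q_open: "openin C (Q i j)" for i j
  proof (cases "i < m")
    case True
    have c: "continuous_map C euclideanreal (\<lambda>p. s k (fst p))" if "k \<le> m" for k
      using continuous_map_compose[OF continuous_map_fst s_cont[OF that]]
      by (simp add: C_def o_def)
    have d: "continuous_map C euclideanreal (\<lambda>p. M * snd p)"
      unfolding C_def
      by (intro continuous_intros continuous_map_into_fulltopology[OF continuous_map_snd])
    define f where "f p = min (s (Suc i) (fst p) + M * snd p) (real j + 1)
        - max (s i (fst p) + M * snd p) (real j)" for p :: "'a \<times> real"
    have "continuous_map C euclideanreal f"
      unfolding f_def using True by (intro continuous_intros c d) auto
    then have "openin C {p \<in> topspace C. 0 < f p}"
      by (simp add: continuous_map_upper_lower_semicontinuous_lt)
    also have "{p \<in> topspace C. 0 < f p} = Q i j"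
      using True by (auto simp: topC Q_def cells_def staircase_cells_def f_def)
    finally show ?thesis .
  next
    case False
    then have "Q i j = {}" using Q_D(1) by fast
    then show ?thesis by simp
  qed

  define O0 where "O0 = (\<Union>i. Q i 0)"
  define E where "E P = (\<Union>(i, j)\<in>{(i, j). i < m \<and> p (h i) = P \<and> N \<le> j}. Q i j) \<union>
      {(x, t). x \<in> pre P \<and> t \<in> {0..1} \<and> real N < M * t}" for P
  define g where "g = (\<lambda>(i, j). if j = 0 then O0 else if j < N then Q i j else E (p (h i)))"
  define L where "L = g ` ({..<m} \<times> {..<N}) \<union> E ` \<P>"
  have L_cases: "S = O0 \<or> (\<exists>i j. S = Q i j \<and> i < m \<and> 0 < j \<and> j < N) \<or> (\<exists>P\<in>\<P>. S = E P)"
    if "S \<in> L" for S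
  proof -
    from that consider P where "P \<in> \<P>" "S = E P" | i j where "i < m" "j < N" "S = g (i, j)"
      unfolding L_def by blast
    then show ?thesis
    proof cases
      case (2 i j)
      then show ?thesis by (cases "j = 0") (auto simp: g_def)
    qed blast
  qed
  have g_in: "g (i, j) \<in> L" if "i < m" for i j
  proof (cases "j < N")
    case True
    then show ?thesis using that by (auto simp: L_def)
  next
    case False
    then have "g (i, j) = E (p (h i))" using Npos by (simp add: g_def)
    then show ?thesis using ap hV[OF that] by (simp add: L_def)
  qed
  have Q_g: "Q i j \<subseteq> g (i, j)" if "i < m" for i j
    using that Npos by (auto simp: g_def O0_def E_def)
  have O0_D: "x \<in> topspace X" "t \<in> {0..1}" "M * t < 1" if "(x, t) \<in> O0" for x t
    using that Q_D[of x t _ 0] by (auto simp: O0_def)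
  have E_D: "x \<in> topspace X" "t \<in> {0..1}" "real N - 1 < M * t" "q x \<in> P"
    if xt: "(x, t) \<in> E P" for x t P
  proof -
    have "x \<in> topspace X \<and> t \<in> {0..1} \<and> real N - 1 < M * t \<and> q x \<in> P"
    proof (cases "x \<in> pre P \<and> t \<in> {0..1} \<and> real N < M * t")
      case True
      then show ?thesis by (auto simp: pre_def)
    next
      case False
      then obtain i j where ij: "i < m" "p (h i) = P" "N \<le> j" "(x, t) \<in> Q i j"
        using xt by (auto simp: E_def)
      have "x \<in> pre P" using Q_D(4)[OF ij(4)] ap[OF hV[OF ij(1)]] ij(2) by blast
      then show ?thesis using Q_D(3,5)[OF ij(4)] ij(3) by (auto simp: pre_def)
    qed
    then show "x \<in> topspace X" "t \<in> {0..1}" "real N - 1 < M * t" "q x \<in> P" by blast+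
  qed
  have Q_ex: "\<exists>i j. i < m \<and> (x, t) \<in> Q i j \<and> j = nat \<lfloor>M * t\<rfloor>"
    if x: "x \<in> topspace X" and t: "t \<in> {0..1}" for x t
  proof -
    have "0 \<le> M * t" using M(1) t by simp
    then obtain i where "(i, nat \<lfloor>M * t\<rfloor>) \<in> cells x t"
      unfolding cells_def by (rule staircase_cells_first[of "\<lambda>i. s i x" m, OF s0 sm[OF x]])
    then have "(x, t) \<in> Q i (nat \<lfloor>M * t\<rfloor>)" using x t by (simp add: Q_def)
    then show ?thesis using Q_D(1) by blast
  qed

  have L_open: "openin C S" if "S \<in> L" for S
  proof -
    have "openin C O0" unfolding O0_def using Q_open by blast
    moreover have "openin C (E P)" if P': "P \<in> \<P>" for P
    proof -
      have "openin (top_of_set {0..1}) {t \<in> {0..1}. real N < M * t}"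
        using openin_continuous_map_preimage[of "top_of_set {0..1}" euclideanreal "\<lambda>t. M * t" "{real N<..}"]
        by (auto intro!: continuous_intros)
      then have "openin C (pre P \<times> {t \<in> {0..1}. real N < M * t})"
        using pre_open[OF P'] unfolding C_def openin_prod_Times_iff by blast
      also have "pre P \<times> {t \<in> {0..1}. real N < M * t} =
          {(x, t). x \<in> pre P \<and> t \<in> {0..1} \<and> real N < M * t}" by auto
      finally show ?thesis unfolding E_def using Q_open by (intro openin_Un openin_Union) auto
    qed
    ultimately show ?thesis using L_cases[OF that] Q_open by metis
  qed
  have L_end0: "S = O0" if "S \<in> L" "(x, 0) \<in> S" for S x
  proof -
    have "(x, 0) \<notin> Q i j" if "0 < j" for i j using Q_D(5)[of x 0 i j] that by auto
    moreover have "(x, 0) \<notin> E P" for P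
    proof
      assume "(x, 0) \<in> E P"
      then obtain i j where "N \<le> j" "(x, 0) \<in> Q i j" by (auto simp: E_def)
      then show False using Q_D(5)[of x 0 i j] Npos by auto
    qed
    ultimately show ?thesis using L_cases[OF that(1)] that(2) by blast
  qed
  have O0_0: "(x, 0) \<in> O0" if "x \<in> topspace X" for x
    using Q_ex[OF that, of 0] by (auto simp: O0_def)
  have L_end1: "(x', 1) \<in> S"
    if S: "S \<in> L" "(x, 1) \<in> S" and x': "x' \<in> topspace X" "q x = q x'" for S x x'
  proof -
    have "(x, 1) \<notin> O0" using O0_D(3)[of x 1] M_def by auto
    moreover have "(x, 1) \<notin> Q i j" if "j < N" for i j
      using Q_D(6)[of x 1 i j] that by (auto simp: M_def)
    ultimately obtain P where P': "P \<in> \<P>" "S = E P" using L_cases[OF S(1)] S(2) by blast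
    then have "q x \<in> P" using E_D S(2) by blast
    then show ?thesis using P'(2) x' by (auto simp: E_def pre_def M_def)
  qed
  have L_sat: "(x, t) \<in> S" if S: "S \<in> L" and xt: "x \<in> topspace X" "t \<in> {0..1}" and F: "F (x, t) \<in> F ` S"
    for S x t
  proof -
    obtain x' t' where x': "(x', t') \<in> S" "F (x, t) = F (x', t')" using F by auto
    have top: "x' \<in> topspace X" "t' \<in> {0..1}"
      using openin_subset[OF L_open[OF S]] x'(1) by (auto simp: topC)
    have "t = t'" and alt: "x = x' \<or> t = 0 \<or> t = 1 \<and> q x = q x'"
      using ker[OF xt(1) top(1) xt(2) top(2)] x'(2) by auto
    from alt show ?thesis
    proof (elim disjE conjE)
      assume "x = x'" then show ?thesis using x'(1) \<open>t = t'\<close> by simp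
    next
      assume "t = 0" then show ?thesis
        using x'(1) \<open>t = t'\<close> L_end0[OF S, of x'] O0_0[OF xt(1)] by simp
    next
      assume "t = 1" "q x = q x'" then show ?thesis
        using x'(1) \<open>t = t'\<close> L_end1[OF S, of x' x] xt(1) by simp
    qed
  qed
  have L_top: "S \<subseteq> topspace C" if "S \<in> L" for S using openin_subset[OF L_open[OF that]] .

  have L_cover: "\<exists>S\<in>L. pt \<in> S" if pt: "pt \<in> topspace C" for pt
  proof -
    obtain x t where xt: "pt = (x, t)" "x \<in> topspace X" "t \<in> {0..1}" using pt by (auto simp: topC)
    obtain i j where "i < m" "pt \<in> Q i j" using Q_ex[OF xt(2,3)] xt(1) by blast
    then show ?thesis using Q_g g_in by blast
  qed
  have L_fin: "finite L" using P(1) by (simp add: L_def finite_open_cover_def)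

  have L_refine: "\<exists>U\<in>\<U>. S \<subseteq> W U" if S: "S \<in> L" "S \<noteq> {}" for S
  proof -
    consider "S = O0" | i j where "S = Q i j" "i < m" "0 < j" "j < N" | P where "P \<in> \<P>" "S = E P"
      using L_cases[OF S(1)] by blast
    then show ?thesis
    proof cases
      case 1
      have "(x, t) \<in> W U0" if xt: "(x, t) \<in> O0" for x t
      proof (rule r0(2))
        show "x \<in> topspace X" "t \<in> {0..1}" using O0_D[OF xt] by auto
        have "0 \<le> M * t" "M * t < 1" using O0_D[OF xt] M(1) by auto
        then show "t < r0" using M'[of t 0] r(2) by auto
      qed
      then have "O0 \<subseteq> W U0" by (rule subrelI)
      then show ?thesis using U0(1) 1 by blast
    next
      case (2 i j)
      have c: "real j / M \<in> {0..1}" using 2(4) M(1) by (auto simp: M_def field_simps)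
      have "a (h i) \<in> \<A>" using ap hV[OF 2(2)] by blast
      then obtain U where U: "U \<in> \<U>" "a (h i) \<times> (ball (real j / M) r1 \<inter> {0..1}) \<subseteq> W U"
        using A(3)[OF _ c] by blast
      have "(x, t) \<in> W U" if xt: "(x, t) \<in> Q i j" for x t
      proof -
        have "\<bar>t - real j / M\<bar> < r1"
          using M'[of t "real j"] Q_D(5,6)[OF xt] r(3) by linarith
        then have "t \<in> ball (real j / M) r1 \<inter> {0..1}"
          using Q_D(3)[OF xt] by (auto simp: dist_real_def)
        moreover have "x \<in> a (h i)" using Q_D(4)[OF xt] ap hV[OF 2(2)] by blast
        ultimately show ?thesis using U(2) by blast
      qed
      then have "Q i j \<subseteq> W U" by (rule subrelI)
      then show ?thesis using U(1) 2(1) by blast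
    next
      case (3 P)
      obtain B where B': "B \<in> \<B>" "P \<subseteq> B" using P(2)[OF 3(1)] by blast
      have "B \<noteq> {}" using S(2) 3(2) E_D(4) B'(2) by fast
      then obtain U where U: "U \<in> \<U>"
        "\<And>x t. x \<in> topspace X \<Longrightarrow> t \<in> {0..1} \<Longrightarrow> q x \<in> B \<Longrightarrow> 1 - r2 < t \<Longrightarrow> (x, t) \<in> W U"
        using ends[OF B'(1)] by metis
      have "(x, t) \<in> W U" if xt: "(x, t) \<in> E P" for x t
      proof (rule U(2))
        show "x \<in> topspace X" "t \<in> {0..1}" "q x \<in> B" using E_D[OF xt] B'(2) by auto
        have "M * t \<le> M" using E_D(2)[OF xt] M(1) by auto
        then have "\<bar>M * t - M\<bar> < 2" using E_D(3)[OF xt] by (auto simp: M_def)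
        then have "\<bar>t - 1\<bar> < r" using M'[of t M] M(1) by simp
        then show "1 - r2 < t" using r(4) by auto
      qed
      then have "E P \<subseteq> W U" by (rule subrelI)
      then show ?thesis using U(1) 3(2) by blast
    qed
  qed

  have L_card: "int (card {S \<in> L. (x, t) \<in> S}) \<le> n + 1"
    if x: "x \<in> topspace X" and t: "t \<in> {0..1}" for x t
  proof (cases "real N < M * t")
    case True
    have "{S \<in> L. (x, t) \<in> S} \<subseteq> E ` {P \<in> \<P>. q x \<in> P}"
    proof
      fix S assume S: "S \<in> {S \<in> L. (x, t) \<in> S}"
      have "(x, t) \<notin> O0" using O0_D(3)[of x t] True Npos by auto
      moreover have "(x, t) \<notin> Q i j" if "j < N" for i j
        using Q_D(6)[of x t i j] True that by auto
      ultimately obtain P where "P \<in> \<P>" "S = E P" using L_cases[of S] S by blast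
      then show "S \<in> E ` {P \<in> \<P>. q x \<in> P}" using E_D(4) S by blast
    qed
    moreover have fin: "finite {P \<in> \<P>. q x \<in> P}" using P(1) by (simp add: finite_open_cover_def)
    ultimately have "card {S \<in> L. (x, t) \<in> S} \<le> card {P \<in> \<P>. q x \<in> P}"
      by (meson surj_card_le)
    then show ?thesis using P(3)[of "q x"] q(3) x by force
  next
    case False
    have "0 \<le> M * t" using M(1) t by simp
    note cells = finite_staircase_cells_card[of m "\<lambda>i. s i x" "M * t", OF smono[OF x] s0 sm[OF x] this,
        folded cells_def]
    have "{S \<in> L. (x, t) \<in> S} \<subseteq> g ` cells x t"
    proof
      fix S assume S: "S \<in> {S \<in> L. (x, t) \<in> S}"
      then consider "S = O0" | i j where "S = Q i j" "i < m" "0 < j" "j < N" | P where "P \<in> \<P>" "S = E P"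
        using L_cases[of S] by blast
      then have "\<exists>i j. (x, t) \<in> Q i j \<and> S = g (i, j)"
      proof cases
        case 1
        then obtain i where "(x, t) \<in> Q i 0" using S by (auto simp: O0_def)
        then show ?thesis using 1 by (intro exI[of _ i] exI[of _ 0]) (simp add: g_def)
      next
        case (2 i j)
        then show ?thesis using S by (intro exI[of _ i] exI[of _ j]) (simp add: g_def)
      next
        case (3 P)
        then obtain i j where "p (h i) = P" "N \<le> j" "(x, t) \<in> Q i j"
          using S False by (auto simp: E_def)
        then show ?thesis using 3 Npos by (intro exI[of _ i] exI[of _ j]) (simp add: g_def)
      qed
      then show "S \<in> g ` cells x t" by (auto simp: Q_def)
    qed
    then have "card {S \<in> L. (x, t) \<in> S} \<le> card (cells x t)"
      by (meson surj_card_le cells(1))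
    also have "\<dots> \<le> card {i. i < m \<and> s i x < s (Suc i) x} + 1" by (rule cells(2))
    also have "card {i. i < m \<and> s i x < s (Suc i) x} \<le> card {V \<in> \<V>. x \<in> V}"
    proof (rule card_inj_on_le[of h])
      show "inj_on h {i. i < m \<and> s i x < s (Suc i) x}"
        using h by (auto simp: bij_betw_def m_def inj_on_def)
      show "h ` {i. i < m \<and> s i x < s (Suc i) x} \<subseteq> {V \<in> \<V>. x \<in> V}"
        using hV s_supp[OF x] by auto
      show "finite {V \<in> \<V>. x \<in> V}" using V(1) by (simp add: finite_open_cover_def)
    qed
    finally have "card {S \<in> L. (x, t) \<in> S} \<le> card {V \<in> \<V>. x \<in> V} + 1" by simp
    then show ?thesis using V(3)[OF x] by linarith
  qed

  show "\<exists>\<V>. finite_open_cover Z \<V> \<and> (\<forall>V\<in>\<V>. \<exists>U\<in>\<U>. V \<subseteq> U) \<and>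
             (\<forall>x\<in>topspace Z. int (card {V \<in> \<V>. x \<in> V}) \<le> n + 1)"
  proof (intro exI[of _ "(`) F ` (L - {{}})"] conjI ballI)
    show "finite_open_cover Z ((`) F ` (L - {{}}))"
      unfolding finite_open_cover_def
    proof (intro conjI ballI)
      show "finite ((`) F ` (L - {{}}))" using L_fin by simp
      fix O' assume "O' \<in> (`) F ` (L - {{}})"
      then obtain S where S: "S \<in> L" "O' = F ` S" by blast
      have "{p \<in> topspace C. F p \<in> F ` S} = S"
      proof
        show "{p \<in> topspace C. F p \<in> F ` S} \<subseteq> S"
          using L_sat[OF S(1)] by (auto simp: topC)
        show "S \<subseteq> {p \<in> topspace C. F p \<in> F ` S}" using L_top[OF S(1)] by blast
      qed
      moreover have "F ` S \<subseteq> topspace Z" using L_top[OF S(1)] F_img by blast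
      ultimately show "openin Z O'" using F_open[of "F ` S"] L_open[OF S(1)] S(2) by simp
    next
      have "\<Union>L = topspace C" using L_top L_cover by blast
      moreover have "\<Union>((`) F ` (L - {{}})) = F ` \<Union>L" by blast
      ultimately show "\<Union>((`) F ` (L - {{}})) = topspace Z" using F_img by simp
    qed
  next
    fix O' assume "O' \<in> (`) F ` (L - {{}})"
    then obtain S where S: "S \<in> L" "S \<noteq> {}" "O' = F ` S" by blast
    then obtain U where U: "U \<in> \<U>" "S \<subseteq> W U" using L_refine by blast
    then have "O' \<subseteq> U" using S(3) by (auto simp: W_def)
    then show "\<exists>U\<in>\<U>. O' \<subseteq> U" using U(1) by blast
  next
    fix z assume "z \<in> topspace Z"
    then obtain x t where xt: "z = F (x, t)" "x \<in> topspace X" "t \<in> {0..1}"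
      unfolding F_img[symmetric] topC by blast
    have "{O' \<in> (`) F ` (L - {{}}). z \<in> O'} \<subseteq> (`) F ` {S \<in> L. (x, t) \<in> S}"
    proof
      fix O' assume O': "O' \<in> {O' \<in> (`) F ` (L - {{}}). z \<in> O'}"
      then obtain S where S: "S \<in> L" "O' = F ` S" by blast
      then have "(x, t) \<in> S" using L_sat[OF S(1) xt(2,3)] O' xt(1) by simp
      then show "O' \<in> (`) F ` {S \<in> L. (x, t) \<in> S}" using S by simp
    qed
    moreover have "finite {S \<in> L. (x, t) \<in> S}" using L_fin by simp
    ultimately have "card {O' \<in> (`) F ` (L - {{}}). z \<in> O'} \<le> card {S \<in> L. (x, t) \<in> S}"
      by (meson surj_card_le)
    then show "int (card {O' \<in> (`) F ` (L - {{}}). z \<in> O'}) \<le> n + 1"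
      using L_card[OF xt(2,3)] by linarith
  qed
qed
lemma (in group) orbit_right_action_eq_iff:
  assumes closed: "\<And>x g. x \<in> E \<Longrightarrow> g \<in> carrier G \<Longrightarrow> a x g \<in> E"
    and one: "\<And>x. x \<in> E \<Longrightarrow> a x \<one> = x"
    and mult: "\<And>x g h. x \<in> E \<Longrightarrow> g \<in> carrier G \<Longrightarrow> h \<in> carrier G \<Longrightarrow> a x (g \<otimes> h) = a (a x g) h"
    and xy: "x \<in> E" "y \<in> E"
  shows "orbit G (\<lambda>g x. a x g) x = orbit G (\<lambda>g x. a x g) y \<longleftrightarrow> (\<exists>g\<in>carrier G. y = a x g)"
proof
  assume "orbit G (\<lambda>g x. a x g) x = orbit G (\<lambda>g x. a x g) y"
  moreover have "y \<in> orbit G (\<lambda>g x. a x g) y"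
    using one[OF xy(2)] unfolding orbit_def by force
  ultimately show "\<exists>g\<in>carrier G. y = a x g" by (auto simp: orbit_def)
next
  assume "\<exists>g\<in>carrier G. y = a x g"
  then obtain g where g: "g \<in> carrier G" "y = a x g" by blast
  show "orbit G (\<lambda>g x. a x g) x = orbit G (\<lambda>g x. a x g) y"
  proof
    show "orbit G (\<lambda>g x. a x g) y \<subseteq> orbit G (\<lambda>g x. a x g) x"
    proof
      fix z assume "z \<in> orbit G (\<lambda>g x. a x g) y"
      then obtain h where h: "h \<in> carrier G" "z = a y h" by (auto simp: orbit_def)
      then have "z = a x (g \<otimes> h)" using g mult[OF xy(1)] by simp
      moreover have "g \<otimes> h \<in> carrier G" using g h by simp
      ultimately show "z \<in> orbit G (\<lambda>g x. a x g) x" unfolding orbit_def by blast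
    qed
    show "orbit G (\<lambda>g x. a x g) x \<subseteq> orbit G (\<lambda>g x. a x g) y"
    proof
      fix z assume "z \<in> orbit G (\<lambda>g x. a x g) x"
      then obtain h where h: "h \<in> carrier G" "z = a x h" by (auto simp: orbit_def)
      have "a y (inv g \<otimes> h) = a x (g \<otimes> (inv g \<otimes> h))" using g h mult[OF xy(1)] by simp
      also have "g \<otimes> (inv g \<otimes> h) = h" using g h by (simp add: m_assoc[symmetric])
      finally have "z = a y (inv g \<otimes> h)" using h by simp
      moreover have "inv g \<otimes> h \<in> carrier G" using g h by simp
      ultimately show "z \<in> orbit G (\<lambda>g x. a x g) y" unfolding orbit_def by blast
    qed
  qed
qed

lemma (in continuous_right_action) continuous_map_act:
  assumes "continuous_map S X f" "continuous_map S T g"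
  shows "continuous_map S X (\<lambda>z. act (f z) (g z))"
proof -
  have "continuous_map S (prod_topology X T) (\<lambda>z. (f z, g z))"
    using assms by (simp add: continuous_map_pairedI)
  from continuous_map_compose[OF this continuous_act] show ?thesis by (simp add: o_def)
qed

lemma (in continuous_right_action) orbit_eq_iff:
  assumes "x \<in> topspace X" "y \<in> topspace X"
  shows "orbit G (\<lambda>g x. act x g) x = orbit G (\<lambda>g x. act x g) y \<longleftrightarrow> (\<exists>g\<in>carrier G. y = act x g)"
  using assms act_closed act_one act_mult by (intro orbit_right_action_eq_iff[of "topspace X"]) auto

lemma (in continuous_right_action) proper_map_orbit:
  assumes T: "compact_space T"
  shows "proper_map X (orbit_space G X act) (orbit G (\<lambda>g x. act x g))"
proof -
  let ?q = "orbit G (\<lambda>g x. act x g)"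
  have "closed_map X (orbit_space G X act) ?q"
    unfolding closed_map_def
  proof (intro allI impI)
    fix K assume K: "closedin X K"
    have sub: "K \<subseteq> topspace X" using K by (rule closedin_subset)
    have "closedin (prod_topology X T) {p \<in> topspace (prod_topology X T). act (fst p) (snd p) \<in> K}"
      using closedin_continuous_map_preimage[OF continuous_act K] by (simp add: case_prod_unfold)
    then have "closedin X (fst ` {p \<in> topspace (prod_topology X T). act (fst p) (snd p) \<in> K})"
      using closed_map_fst[OF T] unfolding closed_map_def by blast
    also have "fst ` {p \<in> topspace (prod_topology X T). act (fst p) (snd p) \<in> K} =
        {x \<in> topspace X. ?q x \<in> ?q ` K}"
    proof (intro equalityI subsetI)
      fix x assume "x \<in> fst ` {p \<in> topspace (prod_topology X T). act (fst p) (snd p) \<in> K}"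
      then obtain g where xg: "x \<in> topspace X" "g \<in> carrier G" "act x g \<in> K"
        by (auto simp: topspace_eq)
      then have "?q x = ?q (act x g)" using orbit_eq_iff[of x "act x g"] act_closed by blast
      then show "x \<in> {x \<in> topspace X. ?q x \<in> ?q ` K}" using xg by blast
    next
      fix x assume "x \<in> {x \<in> topspace X. ?q x \<in> ?q ` K}"
      then obtain y where y: "x \<in> topspace X" "y \<in> K" "?q x = ?q y" by blast
      then obtain g where "g \<in> carrier G" "y = act x g"
        using orbit_eq_iff[of x y] sub by blast
      then show "x \<in> fst ` {p \<in> topspace (prod_topology X T). act (fst p) (snd p) \<in> K}"
        using y by (force simp: topspace_eq)
    qed
    finally have "closedin X {x \<in> topspace X. ?q x \<in> ?q ` K}" .
    moreover have "?q ` K \<subseteq> topspace (orbit_space G X act)"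
      using sub by (auto simp: orbit_space_def)
    ultimately show "closedin (orbit_space G X act) (?q ` K)"
      using quotient_map_quotient_topology[of X ?q]
      unfolding quotient_map_closedin orbit_space_def by blast
  qed
  moreover have "compactin X {x \<in> topspace X. ?q x = y}" if y: "y \<in> topspace (orbit_space G X act)" for y
  proof -
    obtain x where x: "x \<in> topspace X" "y = ?q x" using y by (auto simp: orbit_space_def)
    have "continuous_map T X (\<lambda>g. act x g)" using x by (intro continuous_map_act) auto
    then have "compactin X ((\<lambda>g. act x g) ` topspace T)"
      using T unfolding compact_space_def by (intro image_compactin)
    also have "(\<lambda>g. act x g) ` topspace T = {z \<in> topspace X. ?q z = y}"
    proof (intro equalityI subsetI)
      fix z assume "z \<in> (\<lambda>g. act x g) ` topspace T"
      then obtain g where g: "g \<in> carrier G" "z = act x g" by (auto simp: topspace_eq)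
      then have "?q x = ?q z" using orbit_eq_iff[OF x(1), of z] act_closed[OF x(1)] by blast
      then show "z \<in> {z \<in> topspace X. ?q z = y}" using g act_closed[OF x(1)] x(2) by simp
    next
      fix z assume "z \<in> {z \<in> topspace X. ?q z = y}"
      then have "\<exists>g\<in>carrier G. z = act x g" using orbit_eq_iff[OF x(1), of z] x(2) by simp
      then show "z \<in> (\<lambda>g. act x g) ` topspace T" by (auto simp: topspace_eq)
    qed
    finally show ?thesis .
  qed
  ultimately show ?thesis by (simp add: proper_map_def)
qed

lemma join_class_eq_iff:
  assumes "p \<in> topspace (join_base X Y)" "p' \<in> topspace (join_base X Y)"
  shows "join_class X Y p = join_class X Y p' \<longleftrightarrow> (p, p') \<in> join_rel X Y"
  unfolding join_class_def by (rule eq_equiv_class_iff[OF equiv_join_rel assms])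

definition join_orbit_cone ::
    "('g, 'm) monoid_scheme \<Rightarrow> 'g topology \<Rightarrow> 'a topology \<Rightarrow> ('a \<Rightarrow> 'g \<Rightarrow> 'a)
      \<Rightarrow> 'a \<times> real \<Rightarrow> ('a \<times> 'g \<times> real) set set" where
  "join_orbit_cone G T X act =
     (\<lambda>(x, t). orbit G (\<lambda>g c. join_diag G T X act c g) (join_class X T (x, \<one>\<^bsub>G\<^esub>, t)))"

context continuous_right_action
begin

lemma topspace_join_base: "topspace (join_base X T) = topspace X \<times> carrier G \<times> {0..1}"
  by (simp add: join_base_def topspace_eq)

lemma topspace_join_space:
  "topspace (join_space X T) = join_class X T ` (topspace X \<times> carrier G \<times> {0..1})"
  by (simp add: join_space_def topspace_join_base)

lemma join_orbit_eq_iff: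
  assumes "x \<in> topspace X" "h \<in> carrier G" "t \<in> {0..1}"
    and "x' \<in> topspace X" "h' \<in> carrier G" "t' \<in> {0..1}"
  shows "orbit G (\<lambda>g c. join_diag G T X act c g) (join_class X T (x, h, t)) =
      orbit G (\<lambda>g c. join_diag G T X act c g) (join_class X T (x', h', t')) \<longleftrightarrow>
      (\<exists>g\<in>carrier G. ((x', h', t'), (act x g, h \<otimes> g, t)) \<in> join_rel X T)"
proof -
  let ?E = "topspace (join_space X T)"
  have "orbit G (\<lambda>g c. join_diag G T X act c g) (join_class X T (x, h, t)) =
      orbit G (\<lambda>g c. join_diag G T X act c g) (join_class X T (x', h', t')) \<longleftrightarrow>
      (\<exists>g\<in>carrier G. join_class X T (x', h', t') = join_diag G T X act (join_class X T (x, h, t)) g)"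
  proof (rule orbit_right_action_eq_iff[of ?E])
    fix c g assume "c \<in> ?E" "g \<in> carrier G"
    then show "join_diag G T X act c g \<in> ?E"
      by (auto simp: topspace_join_space join_diag_class act_closed)
  next
    fix c assume "c \<in> ?E"
    then show "join_diag G T X act c \<one> = c"
      by (auto simp: topspace_join_space join_diag_class act_one)
  next
    fix c g k assume "c \<in> ?E" "g \<in> carrier G" "k \<in> carrier G"
    then show "join_diag G T X act c (g \<otimes> k) = join_diag G T X act (join_diag G T X act c g) k"
      by (auto simp: topspace_join_space join_diag_class act_closed act_mult m_assoc)
  qed (use assms in \<open>auto simp: topspace_join_space\<close>)
  also have "\<dots> \<longleftrightarrow> (\<exists>g\<in>carrier G. ((x', h', t'), (act x g, h \<otimes> g, t)) \<in> join_rel X T)"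
    using assms
    by (intro bex_cong refl) (simp add: join_diag_class join_class_eq_iff topspace_join_base act_closed)
  finally show ?thesis .
qed

lemma join_orbit_cone_eq_iff:
  assumes x: "x \<in> topspace X" "t \<in> {0..1}" and x': "x' \<in> topspace X" "t' \<in> {0..1}"
  shows "join_orbit_cone G T X act (x, t) = join_orbit_cone G T X act (x', t') \<longleftrightarrow>
    t = t' \<and> (x = x' \<or> t = 0 \<or> t = 1 \<and> orbit G (\<lambda>g x. act x g) x = orbit G (\<lambda>g x. act x g) x')"
proof -
  have "join_orbit_cone G T X act (x, t) = join_orbit_cone G T X act (x', t') \<longleftrightarrow>
      (\<exists>g\<in>carrier G. ((x', \<one>, t'), (act x g, \<one> \<otimes> g, t)) \<in> join_rel X T)"
    unfolding join_orbit_cone_def prod.case using assms by (intro join_orbit_eq_iff) auto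
  also have "\<dots> \<longleftrightarrow> (\<exists>g\<in>carrier G. t' = t \<and>
      (x' = act x g \<and> g = \<one> \<or> t = 0 \<and> g = \<one> \<or> t = 1 \<and> x' = act x g))"
    using assms act_closed by (intro bex_cong refl) (auto simp: join_rel_def topspace_join_base)
  also have "\<dots> \<longleftrightarrow> t = t' \<and> (x = x' \<or> t = 0 \<or> t = 1 \<and> (\<exists>g\<in>carrier G. x' = act x g))"
    using act_one[OF x(1)] one_closed by metis
  finally show ?thesis by (simp add: orbit_eq_iff[OF x(1) x'(1)])
qed

text \<open>The map \<open>(x, h) \<mapsto> x \<cdot> h\<^sup>-\<^sup>1\<close> induces the identification of \<open>(X \<times> G)/G\<close> with \<open>X\<close>.\<close>

lemma quotient_map_join_orbit_cone:
  "quotient_map (prod_topology X (top_of_set {0..1}))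
     (orbit_space G (join_space X T) (join_diag G T X act)) (join_orbit_cone G T X act)"
proof -
  let ?o = "orbit G (\<lambda>g c. join_diag G T X act c g)"
  let ?Z = "orbit_space G (join_space X T) (join_diag G T X act)"
  let ?C = "prod_topology X (top_of_set {0..1::real})"
  define c where "c = (\<lambda>(x, h, t). (act x (inv h), t :: real))"
  have quot: "quotient_map (join_base X T) ?Z (?o \<circ> join_class X T)"
    unfolding orbit_space_def join_space_def
    by (rule quotient_map_compose[OF quotient_map_quotient_topology quotient_map_quotient_topology])
  have fst1: "continuous_map (join_base X T) X fst"
    unfolding join_base_def by (rule continuous_map_fst)
  have snd1: "continuous_map (join_base X T) T (\<lambda>p. fst (snd p))"
    and snd2: "continuous_map (join_base X T) (top_of_set {0..1}) (\<lambda>p. snd (snd p))"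
    unfolding join_base_def
    using continuous_map_compose[OF continuous_map_snd continuous_map_fst]
      continuous_map_compose[OF continuous_map_snd continuous_map_snd] by (auto simp: o_def)
  have inv1: "continuous_map (join_base X T) T (\<lambda>p. inv (fst (snd p)))"
    using continuous_map_compose[OF snd1 continuous_inv] by (simp add: o_def)
  have c: "continuous_map (join_base X T) ?C c"
    unfolding c_def case_prod_unfold
    by (intro continuous_map_pairedI continuous_map_act fst1 inv1 snd2)
  have "continuous_map ?C (join_base X T) (\<lambda>p. (fst p, \<one>, snd p))"
    unfolding join_base_def
    by (intro continuous_map_pairedI continuous_map_fst continuous_map_snd) (simp add: topspace_eq)
  from continuous_map_compose[OF this quotient_imp_continuous_map[OF quot]]
  have cone: "continuous_map ?C ?Z (join_orbit_cone G T X act)"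
    by (simp add: o_def join_orbit_cone_def case_prod_unfold)
  have "(?o \<circ> join_class X T) p = (join_orbit_cone G T X act \<circ> c) p" if p: "p \<in> topspace (join_base X T)" for p
  proof -
    obtain x h t where xht: "p = (x, h, t)" "x \<in> topspace X" "h \<in> carrier G" "t \<in> {0..1}"
      using p by (auto simp: topspace_join_base)
    have "((act x (inv h), \<one>, t), (act x (inv h), h \<otimes> inv h, t)) \<in> join_rel X T"
      using xht act_closed by (auto simp: join_rel_def topspace_join_base)
    then have "\<exists>g\<in>carrier G. ((act x (inv h), \<one>, t), (act x g, h \<otimes> g, t)) \<in> join_rel X T"
      using xht by (intro bexI[of _ "inv h"]) auto
    then show ?thesis
      using join_orbit_eq_iff[of x h t "act x (inv h)" \<one> t] xht act_closed
      by (simp add: c_def join_orbit_cone_def)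
  qed
  then have "quotient_map (join_base X T) ?Z (join_orbit_cone G T X act \<circ> c)"
    using quotient_map_eq[OF quot] by blast
  then show ?thesis by (rule quotient_map_from_composition[OF c cone])
qed

end

lemma covering_dim_attained:
  assumes "covering_dim X \<noteq> \<infinity>"
  obtains n where "-1 \<le> n" "covering_dim X = ereal (real_of_int n)" "covering_dim_le X n"
proof -
  define S where "S = {n. -1 \<le> n \<and> covering_dim_le X n}"
  have "S \<noteq> {}"
  proof
    assume "S = {}"
    then have "{ereal (real_of_int n) |n. -1 \<le> n \<and> covering_dim_le X n} = {}" by (auto simp: S_def)
    then have "covering_dim X = Inf {}" unfolding covering_dim_def by (rule arg_cong)
    with assms show False by (simp add: top_ereal_def)
  qed
  then obtain k where k: "k \<in> S" by blast
  define n where "n = (LEAST j. j \<in> nat ` (\<lambda>m. m + 1) ` S)"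
  have "n \<in> nat ` (\<lambda>m. m + 1) ` S"
    unfolding n_def by (rule LeastI[of _ "nat (k + 1)"]) (use k in blast)
  then obtain m where m: "m \<in> S" "n = nat (m + 1)" by blast
  have least: "m \<le> l" if "l \<in> S" for l
  proof -
    have "n \<le> nat (l + 1)" unfolding n_def by (rule Least_le) (use that in blast)
    then have "nat (m + 1) \<le> nat (l + 1)" using m(2) by simp
    moreover have "-1 \<le> m" "-1 \<le> l" using m(1) that by (auto simp: S_def)
    ultimately show ?thesis by linarith
  qed
  show thesis
  proof
    show "-1 \<le> m" "covering_dim_le X m" using m(1) by (auto simp: S_def)
    show "covering_dim X = ereal (real_of_int m)"
    proof (rule antisym)
      show "covering_dim X \<le> ereal (real_of_int m)"
        using m(1) by (simp add: S_def covering_dim_le_iff)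
      show "ereal (real_of_int m) \<le> covering_dim X"
        unfolding covering_dim_def using least by (auto intro!: Inf_greatest simp: S_def)
    qed
  qed
qed
theorem lemma2p17:
  fixes X :: "'a topology"
    and G :: "('g, 'm) monoid_scheme"
    and T :: "'g topology"
    and act :: "'a \<Rightarrow> 'g \<Rightarrow> 'a"
  assumes "compact_space X"
    and "metrizable_space X"
    and "topological_group G T"
    and "compact_space T"
    and "free_continuous_right_action G T X act"
  shows "covering_dim (orbit_space G (join_space X T) (join_diag G T X act))
           \<le> max (covering_dim (orbit_space G X act)) (covering_dim X + 1)"
proof (cases "covering_dim (orbit_space G X act) = \<infinity> \<or> covering_dim X = \<infinity>")
  case True
  then show ?thesis by auto
next
  case False
  interpret free_continuous_right_action G T X act by fact
  let ?Y = "orbit_space G X act"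
  let ?Z = "orbit_space G (join_space X T) (join_diag G T X act)"
  obtain k where k: "-1 \<le> k" "covering_dim ?Y = ereal (real_of_int k)" "covering_dim_le ?Y k"
    using covering_dim_attained False by blast
  obtain l where l: "-1 \<le> l" "covering_dim X = ereal (real_of_int l)" "covering_dim_le X l"
    using covering_dim_attained False by blast
  define n where "n = max k (l + 1)"
  have "covering_dim_le ?Z n"
  proof (cases "topspace X = {}")
    case True
    then have "topspace ?Z = {}" 
      by (simp only: orbit_space_def topspace_quotient_topology topspace_join_space) simp
    then have "covering_dim_le ?Z (-1)" by (simp only: covering_dim_le_minus_one_iff)
    then show ?thesis by (rule covering_dim_le_mono) (use k(1) in \<open>simp add: n_def\<close>)
  next
    case ne: False
    have quot: "quotient_map X ?Y (orbit G (\<lambda>g x. act x g))"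
      unfolding orbit_space_def by (rule quotient_map_quotient_topology)
    show ?thesis
    proof (rule covering_dim_le_mapping_cone)
      show "compact_space X" "completely_regular_space X" "topspace X \<noteq> {}"
        using assms(1,2) ne by (auto simp: metrizable_imp_completely_regular_space)
      show "continuous_map X ?Y (orbit G (\<lambda>g x. act x g))"
        using quot by (rule quotient_imp_continuous_map)
      show "orbit G (\<lambda>g x. act x g) ` topspace X = topspace ?Y" by (simp add: orbit_space_def)
      show "proper_map X ?Y (orbit G (\<lambda>g x. act x g))" using assms(4) by (rule proper_map_orbit)
      show "quotient_map (prod_topology X (top_of_set {0..1})) ?Z (join_orbit_cone G T X act)"
        by (rule quotient_map_join_orbit_cone)
      show "covering_dim_le X (n - 1)"
        using l(3) by (rule covering_dim_le_mono) (simp add: n_def)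
      show "covering_dim_le ?Y n"
        using k(3) by (rule covering_dim_le_mono) (simp add: n_def)
    qed (rule join_orbit_cone_eq_iff)
  qed
  then have "covering_dim ?Z \<le> ereal (real_of_int n)"
    using k(1) by (simp add: covering_dim_le_iff n_def)
  also have "\<dots> = max (covering_dim ?Y) (covering_dim X + 1)"
    by (simp add: k(2) l(2) n_def max_def)
  finally show ?thesis .
qed

end
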